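(* Let $G=(V,E)$ be a connected, locally finite weighted graph with a measure $\mu$, let $\Omega\subset V$ be a bounded domain, and let $p>2$. Suppose that $0<\lambda<\lambda_1(\Omega)$ and $f\in H'(\Omega)$, where $H'(\Omega)$ is the dual space of $H(\Omega)$. Then there exists $\epsilon_1>0$ such that for every $\epsilon$ with $0<\epsilon<\epsilon_1$ the problem $$\begin{cases}\Delta^2u=\lambda u+\vert u\vert^{p-2}u+\epsilon f & \text{in } \Omega,\\ u=0 & \text{on } \partial\Omega\end{cases}$$ has two distinct (weak) solutions.
   Context: $G=(V,E)$ is a graph with vertex set $V$ and edge set $E$. It is locally finite (each vertex has finitely many neighbours) and connected. Write $y\sim x$ for $xy\in E$. Each edge $xy$ has a weight $\omega_{xy}=\omega_{yx}>0$, and $\mu:V\to(0,\infty)$ is a positive function defining a measure, with $\int_A u\,d\mu=\sum_{x\in A}\mu(x)u(x)$ for $A\subset V$. $\Omega\subset V$ is a bounded domain (nonempty, of finite diameter in the graph distance, hence finite), with boundary $\partial\Omega=\{y\notin\Omega:\exists x\in\Omega \text{ with } xy\in E\}$. For $u:V\to\mathbb{R}$, $$\Delta u(x)=\frac1{\mu(x)}\sum_{y\sim x}\omega_{xy}(u(y)-u(x)),\qquad \vert\nabla u\vert^2(x)=\frac1{2\mu(x)}\sum_{y\sim x}\omega_{xy}(u(y)-u(x))^2.$$ $W^{2,2}(\Omega)$ is the space of functions $u:V\to\mathbb{R}$ under the norm $\left(\int_{\Omega\cup\partial\Omega}(\vert\Delta u\vert^2+\vert\nabla u\vert^2)d\mu+\int_\Omega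 u^2d\mu\right)^{1/2}$. $C_c(\Omega)$ is the space of functions on $V$ supported in $\Omega$, and $W_0^{1,2}(\Omega)$ is the completion of $C_c(\Omega)$ under the norm $\left(\int_{\Omega\cup\partial\Omega}\vert\nabla u\vert^2d\mu+\int_\Omega u^2d\mu\right)^{1/2}$. Set $H=H(\Omega)=W^{2,2}(\Omega)\cap W_0^{1,2}(\Omega)$; since $\Omega$ is finite, this is the finite-dimensional space of functions $u:V\to\mathbb{R}$ vanishing outside $\Omega$. It is equipped with the norm $\Vert u\Vert_H=\left(\int_{\Omega\cup\partial\Omega}\vert\Delta u\vert^2d\mu\right)^{1/2}$. A function $f$ on $V$ is regarded as an element of the dual $H'(\Omega)$ via $u\mapsto\int_\Omega fu\,d\mu$. Define $$\lambda_1(\Omega)=\inf_{u\in H,\ u\not\equiv0}\frac{\int_{\Omega\cup\partial\Omega}\vert\Delta u\vert^2d\mu}{\int_\Omega u^2d\mu}.$$ A function $u\in H$ is a weak solution of the problem if for every $\varphi\in C_c(\Omega)$, $$\int_{\Omega\cup\partial\Omega}\Delta u\,\Delta\varphi\,d\mu=\lambda\int_\Omega u\varphi\,d\mu+\int_\Omega\vert u\vert^{p-2}u\varphi\,d\mu+\epsilon\int_\Omega f\varphi\,d\mu.$$ *)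

theory Defs
  imports Complex_Main
begin

text \<open>
  The vertex set \<open>V\<close> is the whole type \<open>'v\<close>.  The edge set is a symmetric relation \<open>E\<close>, and
  \<open>y \<sim> x\<close> is \<open>(x, y) \<in> E\<close>.  Loops are not excluded: they contribute nothing to the Laplacian
  and never create boundary vertices.  The weight \<open>\<omega> x y\<close> is only meaningful on edges.
\<close>

locale weighted_graph =
  fixes E :: "('v \<times> 'v) set" and \<omega> :: "'v \<Rightarrow> 'v \<Rightarrow> real" and \<mu> :: "'v \<Rightarrow> real"
  assumes edge_sym: "sym E"
    and locally_finite: "\<And>x. finite {y. (x, y) \<in> E}"
    and graph_connected: "\<And>x y. (x, y) \<in> E\<^sup>*"
    and weight_sym: "\<And>x y. (x, y) \<in> E \<Longrightarrow> \<omega> x y = \<omega> y x"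
    and weight_pos: "\<And>x y. (x, y) \<in> E \<Longrightarrow> \<omega> x y > 0"
    and measure_pos: "\<And>x. \<mu> x > 0"

definition graph_dist :: "('v \<times> 'v) set \<Rightarrow> 'v \<Rightarrow> 'v \<Rightarrow> nat" where
  "graph_dist E x y = (LEAST n. (x, y) \<in> E ^^ n)"

text \<open>As \<open>E\<close> is locally finite and connected, bounded domains are finite.\<close>

definition bounded_domain :: "('v \<times> 'v) set \<Rightarrow> 'v set \<Rightarrow> bool" where
  "bounded_domain E \<Omega> \<longleftrightarrow> \<Omega> \<noteq> {} \<and> (\<exists>D. \<forall>x\<in>\<Omega>. \<forall>y\<in>\<Omega>. graph_dist E x y \<le> D)"

definition boundary :: "('v \<times> 'v) set \<Rightarrow> 'v set \<Rightarrow> 'v set" where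
  "boundary E \<Omega> = {y. y \<notin> \<Omega> \<and> (\<exists>x\<in>\<Omega>. (x, y) \<in> E)}"

text \<open>Only used for the finite sets \<open>\<Omega>\<close> and \<open>\<Omega> \<union> \<partial>\<Omega>\<close>.\<close>

definition graph_integral :: "('v \<Rightarrow> real) \<Rightarrow> 'v set \<Rightarrow> ('v \<Rightarrow> real) \<Rightarrow> real" where
  "graph_integral \<mu> A u = (\<Sum>x\<in>A. \<mu> x * u x)"

definition laplacian ::
    "('v \<times> 'v) set \<Rightarrow> ('v \<Rightarrow> 'v \<Rightarrow> real) \<Rightarrow> ('v \<Rightarrow> real) \<Rightarrow> ('v \<Rightarrow> real) \<Rightarrow> 'v \<Rightarrow> real" where
  "laplacian E \<omega> \<mu> u x = 1 / \<mu> x * (\<Sum>y | (x, y) \<in> E. \<omega> x y * (u y - u x))"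

definition Cc :: "'v set \<Rightarrow> ('v \<Rightarrow> real) set" where
  "Cc \<Omega> = {u. \<forall>x. x \<notin> \<Omega> \<longrightarrow> u x = 0}"

text \<open>
  \<open>H(\<Omega>) = W\<^sup>2\<^sup>,\<^sup>2(\<Omega>) \<inter> W\<^sub>0\<^sup>1\<^sup>,\<^sup>2(\<Omega>)\<close>.  For finite \<open>\<Omega>\<close> the space \<open>C\<^sub>c(\<Omega>)\<close> is finite-dimensional,
  hence complete and equal to its completion \<open>W\<^sub>0\<^sup>1\<^sup>,\<^sup>2(\<Omega>)\<close>, and every function \<open>V \<rightarrow> \<real>\<close> has finite
  \<open>W\<^sup>2\<^sup>,\<^sup>2(\<Omega>)\<close> norm, so that \<open>H(\<Omega>)\<close> is the space of functions vanishing outside \<open>\<Omega>\<close>.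
\<close>

definition H :: "'v set \<Rightarrow> ('v \<Rightarrow> real) set" where
  "H \<Omega> = {u. \<forall>x. x \<notin> \<Omega> \<longrightarrow> u x = 0}"

definition H_norm ::
    "('v \<times> 'v) set \<Rightarrow> ('v \<Rightarrow> 'v \<Rightarrow> real) \<Rightarrow> ('v \<Rightarrow> real) \<Rightarrow> 'v set \<Rightarrow> ('v \<Rightarrow> real) \<Rightarrow> real" where
  "H_norm E \<omega> \<mu> \<Omega> u =
     sqrt (graph_integral \<mu> (\<Omega> \<union> boundary E \<Omega>) (\<lambda>x. \<bar>laplacian E \<omega> \<mu> u x\<bar>\<^sup>2))"

text \<open>
  A function \<open>f\<close> is identified with the functional \<open>u \<mapsto> \<integral>\<^sub>\<Omega> f u d\<mu>\<close> on \<open>H(\<Omega>)\<close>, which is linear by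
  construction; membership in the dual is its boundedness.
\<close>

definition H_dual ::
    "('v \<times> 'v) set \<Rightarrow> ('v \<Rightarrow> 'v \<Rightarrow> real) \<Rightarrow> ('v \<Rightarrow> real) \<Rightarrow> 'v set \<Rightarrow> ('v \<Rightarrow> real) set" where
  "H_dual E \<omega> \<mu> \<Omega> =
     {f. \<exists>C. \<forall>u\<in>H \<Omega>. \<bar>graph_integral \<mu> \<Omega> (\<lambda>x. f x * u x)\<bar> \<le> C * H_norm E \<omega> \<mu> \<Omega> u}"

definition lambda1 ::
    "('v \<times> 'v) set \<Rightarrow> ('v \<Rightarrow> 'v \<Rightarrow> real) \<Rightarrow> ('v \<Rightarrow> real) \<Rightarrow> 'v set \<Rightarrow> real" where
  "lambda1 E \<omega> \<mu> \<Omega> =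
     (INF u \<in> {u \<in> H \<Omega>. u \<noteq> (\<lambda>x. 0)}.
        graph_integral \<mu> (\<Omega> \<union> boundary E \<Omega>) (\<lambda>x. \<bar>laplacian E \<omega> \<mu> u x\<bar>\<^sup>2)
          / graph_integral \<mu> \<Omega> (\<lambda>x. (u x)\<^sup>2))"

text \<open>
  Weak solutions of \<open>\<Delta>\<^sup>2u = \<lambda>u + |u|\<^sup>p\<^sup>-\<^sup>2u + \<epsilon>f\<close> in \<open>\<Omega>\<close>; the boundary condition \<open>u = 0\<close> is
  contained in \<open>u \<in> H(\<Omega>)\<close>.
\<close>

definition weak_solution ::
    "('v \<times> 'v) set \<Rightarrow> ('v \<Rightarrow> 'v \<Rightarrow> real) \<Rightarrow> ('v \<Rightarrow> real) \<Rightarrow> 'v set \<Rightarrow>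
     real \<Rightarrow> real \<Rightarrow> real \<Rightarrow> ('v \<Rightarrow> real) \<Rightarrow> ('v \<Rightarrow> real) \<Rightarrow> bool" where
  "weak_solution E \<omega> \<mu> \<Omega> lam p \<epsilon> f u \<longleftrightarrow>
     u \<in> H \<Omega> \<and>
     (\<forall>\<phi>\<in>Cc \<Omega>.
        graph_integral \<mu> (\<Omega> \<union> boundary E \<Omega>) (\<lambda>x. laplacian E \<omega> \<mu> u x * laplacian E \<omega> \<mu> \<phi> x) =
          lam * graph_integral \<mu> \<Omega> (\<lambda>x. u x * \<phi> x)
          + graph_integral \<mu> \<Omega> (\<lambda>x. \<bar>u x\<bar> powr (p - 2) * u x * \<phi> x)
          + \<epsilon> * graph_integral \<mu> \<Omega> (\<lambda>x. f x * \<phi> x))"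

end

(*
  On the finite-dimensional space H, the weak solutions are the critical points of
    J(u) = q(u,u)/2 - (1/p) \<integral> |u|^p - \<epsilon> \<integral> f u,
  where q(u,w) = \<integral> \<Delta>u \<Delta>w - \<lambda> \<integral> u w is positive definite because \<lambda> < \<lambda>_1. As p > 2, on a small
  sphere q(u,u) = r^2 the radial derivative J'(u)u is positive for all small \<epsilon>. Hence the minimum
  of J over the ball q(u,u) \<le> r^2 is attained inside, which is the first solution.
  The second one minimises J over the part of the Nehari set J'(u)u = 0 outside that ball. Along
  the ray through such a u, t \<mapsto> J(tu) rises up to t = 1 and falls afterwards. If J'(u)w < 0 at a
  minimiser u, then for small s > 0 the segment t \<mapsto> tu + sw, t near 1, meets the Nehari set by the
  intermediate value theorem, at a point where J(tu + sw) < J(tu) \<le> J(u): a contradiction.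
*)
theory Submission
  imports Defs "HOL-Analysis.Analysis"
begin

section \<open>Bounded domains are finite\<close>

lemma finite_graph_sphere:
  fixes E :: "('v \<times> 'v) set"
  assumes "\<And>x. finite {y. (x, y) \<in> E}"
  shows "finite {y. (x, y) \<in> E ^^ n}"
proof (induction n)
  case 0
  then show ?case by simp
next
  case (Suc n)
  have "{y. (x, y) \<in> E ^^ Suc n} = (\<Union>z\<in>{z. (x, z) \<in> E ^^ n}. {y. (z, y) \<in> E})"
    by auto
  then show ?case using Suc assms by simp
qed

text \<open>Seen from one of its points, the domain lies in finitely many sets of endpoints of walks
  of fixed length, each finite by local finiteness. Connectedness supplies a walk to every vertex,
  so that the \<open>LEAST\<close> in \<open>graph_dist\<close> is attained.\<close>

lemma (in weighted_graph) finite_bounded_domain: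
  assumes "bounded_domain E \<Omega>"
  shows "finite \<Omega>"
proof -
  obtain D where D: "\<And>x y. x \<in> \<Omega> \<Longrightarrow> y \<in> \<Omega> \<Longrightarrow> graph_dist E x y \<le> D"
    using assms unfolding bounded_domain_def by blast
  obtain x where x: "x \<in> \<Omega>" using assms unfolding bounded_domain_def by blast
  have "\<Omega> \<subseteq> (\<Union>n\<in>{..D}. {y. (x, y) \<in> E ^^ n})"
  proof
    fix y assume y: "y \<in> \<Omega>"
    obtain n where "(x, y) \<in> E ^^ n"
      using graph_connected[of x y] rtrancl_imp_relpow by blast
    then have "(x, y) \<in> E ^^ graph_dist E x y"
      unfolding graph_dist_def by (rule LeastI)
    then show "y \<in> (\<Union>n\<in>{..D}. {y. (x, y) \<in> E ^^ n})"
      using D[OF x y] by blast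
  qed
  then show ?thesis
    using finite_graph_sphere[OF locally_finite] by (meson finite_UN finite_atMost finite_subset)
qed

section \<open>The Laplacian and the first eigenvalue\<close>

lemma laplacian_lincomb:
  "laplacian E \<omega> \<mu> (\<lambda>x. a * u x + b * w x) x = a * laplacian E \<omega> \<mu> u x + b * laplacian E \<omega> \<mu> w x"
  unfolding laplacian_def
  by (simp add: sum_distrib_left sum.distrib[symmetric] algebra_simps)

text \<open>The quotients are nonnegative, so the infimum is a genuine lower bound. Clearing the
  denominator lets the estimate cover \<open>u = 0\<close> as well.\<close>

lemma (in weighted_graph) lambda1_le_quotient:
  assumes "finite \<Omega>" and "u \<in> H \<Omega>"
  shows "lambda1 E \<omega> \<mu> \<Omega> * graph_integral \<mu> \<Omega> (\<lambda>x. (u x)\<^sup>2)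
    \<le> graph_integral \<mu> (\<Omega> \<union> boundary E \<Omega>) (\<lambda>x. \<bar>laplacian E \<omega> \<mu> u x\<bar>\<^sup>2)"
proof (cases "u = (\<lambda>x. 0)")
  case True
  then show ?thesis
    unfolding graph_integral_def laplacian_def by simp
next
  case False
  have nonneg: "0 \<le> graph_integral \<mu> A (\<lambda>x. (v x)\<^sup>2)" for A and v :: "'v \<Rightarrow> real"
    unfolding graph_integral_def using measure_pos by (intro sum_nonneg) (simp add: less_imp_le)
  obtain y where y: "u y \<noteq> 0" using False by auto
  then have "y \<in> \<Omega>" using assms(2) unfolding H_def by blast
  have pos: "0 < graph_integral \<mu> \<Omega> (\<lambda>x. (u x)\<^sup>2)"
    unfolding graph_integral_def
    by (rule sum_pos2[OF assms(1) \<open>y \<in> \<Omega>\<close>]) (use y measure_pos in \<open>auto simp: less_imp_le\<close>)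
  have "lambda1 E \<omega> \<mu> \<Omega> \<le> graph_integral \<mu> (\<Omega> \<union> boundary E \<Omega>) (\<lambda>x. \<bar>laplacian E \<omega> \<mu> u x\<bar>\<^sup>2)
      / graph_integral \<mu> \<Omega> (\<lambda>x. (u x)\<^sup>2)"
    unfolding lambda1_def
    by (rule cINF_lower) (use assms False nonneg in \<open>auto intro!: bdd_belowI[of _ 0]\<close>)
  then show ?thesis using pos by (simp add: pos_le_divide_eq)
qed

section \<open>Calculus of real powers\<close>

text \<open>Away from 0 the sign of \<open>x\<close> removes the absolute value locally. At 0 the
  difference quotient is at most \<open>\<bar>h\<bar> powr (p - 1)\<close> in absolute value, which
  tends to 0 because \<open>p > 1\<close>.\<close>

lemma DERIV_abs_powr:
  fixes x p :: real
  assumes "p > 1"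
  shows "((\<lambda>x. \<bar>x\<bar> powr p) has_real_derivative p * \<bar>x\<bar> powr (p - 2) * x) (at x)"
proof -
  consider "x > 0" | "x < 0" | "x = 0" by linarith
  then show ?thesis
  proof cases
    case 1
    have "((\<lambda>x. x powr p) has_real_derivative p * \<bar>x\<bar> powr (p - 2) * x) (at x)"
      using 1 has_real_derivative_powr[of x p] powr_mult_base[of x "p - 2"]
      by (simp add: mult.left_commute mult.commute[of _ x])
    moreover have ev: "\<forall>\<^sub>F y in nhds x. y powr p = \<bar>y\<bar> powr p"
      by (rule eventually_nhds_in_open[of "{0<..}", THEN eventually_mono]) (use 1 in auto)
    ultimately show ?thesis using DERIV_cong_ev[OF refl ev refl] by blast
  next
    case 2
    have base: "(- x) powr (p - 1) = - (x * (- x) powr (p - 2))"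
      using 2 powr_mult_base[of "-x" "p - 2"] by simp
    have "((\<lambda>x. (- x) powr p) has_real_derivative p * \<bar>x\<bar> powr (p - 2) * x) (at x)"
      using 2 by (auto intro!: derivative_eq_intros simp: base)
    moreover have ev: "\<forall>\<^sub>F y in nhds x. (- y) powr p = \<bar>y\<bar> powr p"
      by (rule eventually_nhds_in_open[of "{..<0}", THEN eventually_mono]) (use 2 in auto)
    ultimately show ?thesis using DERIV_cong_ev[OF refl ev refl] by blast
  next
    case 3
    have "((\<lambda>h::real. \<bar>h\<bar> powr (p - 1)) \<longlongrightarrow> 0) (at 0)"
    proof -
      have "isCont (\<lambda>h::real. \<bar>h\<bar> powr (p - 1)) 0"
        using continuous_on_powr'[of UNIV "\<lambda>h::real. \<bar>h\<bar>" "\<lambda>h. p - 1"] assms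
        by (auto simp: continuous_on_eq_continuous_at intro!: continuous_intros)
      then show ?thesis using assms by (simp add: isCont_def)
    qed
    then have "((\<lambda>h::real. \<bar>h\<bar> powr p / h) \<longlongrightarrow> 0) (at 0)"
    proof (rule Lim_null_comparison[rotated])
      show "\<forall>\<^sub>F h::real in at 0. norm (\<bar>h\<bar> powr p / h) \<le> \<bar>h\<bar> powr (p - 1)"
        by (auto simp: eventually_at_filter powr_diff intro!: always_eventually)
    qed
    then show ?thesis using 3 assms by (simp add: DERIV_def)
  qed
qed

text \<open>An affine function minus a nonnegative multiple of a convex power is concave. Stated for
  positive arguments, it serves to compare values along a ray.\<close>

lemma concave_line_power:
  fixes A B C a s t \<theta> :: real
  assumes "a \<ge> 1" "B \<ge> 0" "t > 0" "0 < s" "0 \<le> \<theta>" "\<theta> \<le> 1"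
  defines "\<psi> \<equiv> \<lambda>t. A * t - B * t powr a - C"
  shows "(1 - \<theta>) * \<psi> s + \<theta> * \<psi> t \<le> \<psi> ((1 - \<theta>) * s + \<theta> * t)"
proof -
  have "((1 - \<theta>) * s + \<theta> * t) powr a \<le> (1 - \<theta>) * s powr a + \<theta> * t powr a"
    using convex_onD[OF powr_convex[OF assms(1)] assms(5,6)] assms(3,4) by simp
  then have "B * ((1 - \<theta>) * s + \<theta> * t) powr a \<le> B * ((1 - \<theta>) * s powr a + \<theta> * t powr a)"
    using assms(2) by (rule mult_left_mono)
  then show ?thesis unfolding \<psi>_def by (simp add: algebra_simps)
qed

section \<open>The energy functional of an abstract coercive form\<close>

text \<open>Separates the variational argument from the graph: \<open>q\<close> stands for the
  bilinear form with the \<lambda> term included, and \<open>c\<close> for the gap between \<lambda>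
  and the first eigenvalue. Continuity refers to the product topology on functions.\<close>

locale power_functional =
  fixes \<Omega> :: "'v set" and \<mu> :: "'v \<Rightarrow> real" and q :: "('v \<Rightarrow> real) \<Rightarrow> ('v \<Rightarrow> real) \<Rightarrow> real"
    and c p :: real
  assumes finite_domain: "finite \<Omega>"
    and domain_nonempty: "\<Omega> \<noteq> {}"
    and measure_pos: "\<And>x. x \<in> \<Omega> \<Longrightarrow> \<mu> x > 0"
    and q_lincomb: "\<And>a b u w \<phi>. q (\<lambda>x. a * u x + b * w x) \<phi> = a * q u \<phi> + b * q w \<phi>"
    and q_sym: "\<And>u w. q u w = q w u"
    and q_cont: "continuous_on UNIV (\<lambda>u. q u u)"
    and c_pos: "c > 0"
    and q_coercive: "\<And>u. u \<in> H \<Omega> \<Longrightarrow> c * (\<Sum>x\<in>\<Omega>. \<mu> x * (u x)\<^sup>2) \<le> q u u"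
    and p_gt_2: "p > 2"
begin

definition pmass :: "('v \<Rightarrow> real) \<Rightarrow> real" where
  "pmass u = (\<Sum>x\<in>\<Omega>. \<mu> x * \<bar>u x\<bar> powr p)"

definition pairing :: "('v \<Rightarrow> real) \<Rightarrow> ('v \<Rightarrow> real) \<Rightarrow> real" where
  "pairing g u = (\<Sum>x\<in>\<Omega>. \<mu> x * (g x * u x))"

definition energy :: "('v \<Rightarrow> real) \<Rightarrow> ('v \<Rightarrow> real) \<Rightarrow> real" where
  "energy g u = q u u / 2 - pmass u / p - pairing g u"

text \<open>The directional derivative of \<open>energy g\<close> at \<open>u\<close> towards
  \<open>w\<close>, as \<open>DERIV_energy_line\<close> confirms. The Nehari condition is
  \<open>denergy g u u = 0\<close>.\<close>

definition denergy :: "('v \<Rightarrow> real) \<Rightarrow> ('v \<Rightarrow> real) \<Rightarrow> ('v \<Rightarrow> real) \<Rightarrow> real" where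
  "denergy g u w = q u w - (\<Sum>x\<in>\<Omega>. \<mu> x * (\<bar>u x\<bar> powr (p - 2) * u x * w x)) - pairing g w"

definition critical :: "('v \<Rightarrow> real) \<Rightarrow> ('v \<Rightarrow> real) \<Rightarrow> bool" where
  "critical g u \<longleftrightarrow> u \<in> H \<Omega> \<and> (\<forall>w\<in>H \<Omega>. denergy g u w = 0)"

lemma q_lincomb_self:
  "q (\<lambda>x. a * u x + b * w x) (\<lambda>x. a * u x + b * w x)
    = a\<^sup>2 * q u u + 2 * a * b * q u w + b\<^sup>2 * q w w"
  by (simp add: q_lincomb q_sym[of _ "\<lambda>x. a * u x + b * w x"] q_sym[of w u]
      power2_eq_square algebra_simps)

lemma q_scale_self: "q (\<lambda>x. t * u x) (\<lambda>x. t * u x) = t\<^sup>2 * q u u"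
  using q_lincomb_self[of t u 0 u] by simp

lemma q_minus_right: "q u (\<lambda>x. - w x) = - q u w"
  using q_lincomb[of "-1" w 0 w u] by (simp add: q_sym)

lemma abs_powr_scale_mult: "\<bar>y::real\<bar> powr (p - 2) * y * y = \<bar>y\<bar> powr p"
proof -
  have "\<bar>y\<bar> powr 2 = y * y"
    by (cases "y = 0") (simp_all add: power2_eq_square)
  moreover have "\<bar>y\<bar> powr p = \<bar>y\<bar> powr (p - 2) * \<bar>y\<bar> powr 2"
    using powr_add[of "\<bar>y\<bar>" "p - 2" 2] by simp
  ultimately show ?thesis by (simp add: mult.assoc)
qed

lemma denergy_self: "denergy g u u = q u u - pmass u - pairing g u"
  unfolding denergy_def pmass_def by (simp add: abs_powr_scale_mult)

lemma denergy_minus: "denergy g u (\<lambda>x. - w x) = - denergy g u w"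
  unfolding denergy_def pairing_def by (simp add: q_minus_right sum_negf)

lemma pmass_scale: "t > 0 \<Longrightarrow> pmass (\<lambda>x. t * u x) = t powr p * pmass u"
  unfolding pmass_def by (simp add: abs_mult powr_mult sum_distrib_left algebra_simps)

lemma pairing_scale: "pairing g (\<lambda>x. t * u x) = t * pairing g u"
  unfolding pairing_def by (simp add: sum_distrib_left algebra_simps)

text \<open>Pulling out one factor \<open>t\<close> leaves a linear term minus a power with exponent
  \<open>p - 1 > 1\<close>, the shape to which \<open>concave_line_power\<close> applies.\<close>

lemma denergy_ray:
  assumes "t > 0"
  shows "denergy g (\<lambda>x. t * u x) (\<lambda>x. t * u x)
    = t * (q u u * t - pmass u * t powr (p - 1) - pairing g u)"
proof -
  have "t powr p = t * t powr (p - 1)" using assms by (simp add: powr_mult_base)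
  then show ?thesis
    unfolding denergy_self using assms
    by (simp add: q_scale_self pmass_scale pairing_scale power2_eq_square algebra_simps)
qed

lemma DERIV_energy_line:
  "((\<lambda>s. energy g (\<lambda>x. u x + s * w x)) has_real_derivative
     denergy g (\<lambda>x. u x + s * w x) w) (at s)"
proof -
  have qq: "q (\<lambda>x. u x + s * w x) (\<lambda>x. u x + s * w x) = q u u + 2 * s * q u w + s\<^sup>2 * q w w" for s
    using q_lincomb_self[of 1 u s w] by simp
  have qw: "q (\<lambda>x. u x + s * w x) w = q u w + s * q w w"
    using q_lincomb[of 1 u s w] by simp
  have powr: "((\<lambda>s. \<bar>u x + s * w x\<bar> powr p) has_real_derivative
      p * \<bar>u x + s * w x\<bar> powr (p - 2) * (u x + s * w x) * w x) (at s)" for x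
    by (rule DERIV_chain2[OF DERIV_abs_powr]) (use p_gt_2 in \<open>auto intro!: derivative_eq_intros\<close>)
  have P: "((\<lambda>s. pmass (\<lambda>x. u x + s * w x)) has_real_derivative
      (\<Sum>x\<in>\<Omega>. \<mu> x * (p * \<bar>u x + s * w x\<bar> powr (p - 2) * (u x + s * w x) * w x))) (at s)"
    unfolding pmass_def by (intro DERIV_sum DERIV_cmult powr)
  have F: "((\<lambda>s. pairing g (\<lambda>x. u x + s * w x)) has_real_derivative pairing g w) (at s)"
    unfolding pairing_def by (rule DERIV_sum) (auto intro!: derivative_eq_intros)
  have Q: "((\<lambda>s. (q u u + 2 * s * q u w + s\<^sup>2 * q w w) / 2) has_real_derivative
      q u w + s * q w w) (at s)"
    by (auto intro!: derivative_eq_intros)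
  have "((\<lambda>s. energy g (\<lambda>x. u x + s * w x)) has_real_derivative
     q u w + s * q w w
     - (\<Sum>x\<in>\<Omega>. \<mu> x * (p * \<bar>u x + s * w x\<bar> powr (p - 2) * (u x + s * w x) * w x)) / p
     - pairing g w) (at s)"
    unfolding energy_def qq by (intro DERIV_diff DERIV_cdivide Q P F)
  moreover have "(\<Sum>x\<in>\<Omega>. \<mu> x * (p * \<bar>u x + s * w x\<bar> powr (p - 2) * (u x + s * w x) * w x)) / p
     = (\<Sum>x\<in>\<Omega>. \<mu> x * (\<bar>u x + s * w x\<bar> powr (p - 2) * (u x + s * w x) * w x))"
    unfolding sum_divide_distrib using p_gt_2 by (intro sum.cong) auto
  ultimately show ?thesis unfolding denergy_def qw by simp
qed

section \<open>Continuity in the product topology\<close>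

text \<open>Positivity of the exponent gives continuity at the zeros of \<open>h\<close>. The
  exponents used are \<open>p\<close> and \<open>p - 2\<close>.\<close>

lemma continuous_abs_powr:
  fixes h :: "'b::topological_space \<Rightarrow> real"
  assumes "continuous_on S h" "a > 0"
  shows "continuous_on S (\<lambda>u. \<bar>h u\<bar> powr a)"
  using assms by (intro continuous_on_powr' continuous_intros) auto

lemma continuous_pmass: "continuous_on UNIV pmass"
  unfolding pmass_def using p_gt_2
  by (intro continuous_on_sum continuous_on_mult continuous_on_const continuous_abs_powr) auto

lemma continuous_pairing: "continuous_on UNIV (pairing g)"
  unfolding pairing_def by (intro continuous_intros) auto

lemma continuous_energy: "continuous_on UNIV (energy g)"
  unfolding energy_def using p_gt_2
  by (intro continuous_intros q_cont continuous_pmass continuous_pairing) auto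

lemma continuous_denergy_self: "continuous_on UNIV (\<lambda>u. denergy g u u)"
  unfolding denergy_self by (intro continuous_intros q_cont continuous_pmass continuous_pairing)

text \<open>Treats both coefficients as variables at once, so that strict inequalities at one pair
  of coefficients persist on a neighbourhood in the plane.\<close>

lemma continuous_lincomb:
  "continuous_on UNIV (\<lambda>z::real \<times> real. (\<lambda>x. fst z * u x + snd z * w x :: real))"
  by (intro continuous_on_coordinatewise_then_product continuous_intros)

lemma continuous_q_lincomb:
  "continuous_on UNIV (\<lambda>z::real \<times> real.
     q (\<lambda>x. fst z * u x + snd z * w x) (\<lambda>x. fst z * u x + snd z * w x))"
  using continuous_on_compose2[OF q_cont continuous_lincomb] by simp

lemma continuous_denergy_self_lincomb:
  "continuous_on UNIV (\<lambda>z::real \<times> real.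
     denergy g (\<lambda>x. fst z * u x + snd z * w x) (\<lambda>x. fst z * u x + snd z * w x))"
  using continuous_on_compose2[OF continuous_denergy_self continuous_lincomb] by simp

lemma continuous_denergy_lincomb:
  "continuous_on UNIV (\<lambda>z::real \<times> real. denergy g (\<lambda>x. fst z * u x + snd z * w x) w)"
  unfolding denergy_def q_lincomb using p_gt_2
  by (intro continuous_intros continuous_abs_powr) auto

section \<open>Coercivity, compactness and the barrier sphere\<close>

lemma q_nonneg: "u \<in> H \<Omega> \<Longrightarrow> 0 \<le> q u u"
  using q_coercive[of u] c_pos sum_nonneg[of \<Omega> "\<lambda>x. \<mu> x * (u x)\<^sup>2"] measure_pos
  by (smt (verit) mult_nonneg_nonneg zero_le_power2)

text \<open>Coercivity bounds each single term \<open>c * \<mu> x * (u x)\<^sup>2\<close> by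
  \<open>q u u\<close>; summing the resulting constants over the finite domain gives one
  \<open>M\<close> for all vertices.\<close>

lemma sup_bound:
  obtains M where "M > 0" "\<And>u x. u \<in> H \<Omega> \<Longrightarrow> \<bar>u x\<bar> \<le> M * sqrt (q u u)"
proof
  define M where "M = (\<Sum>x\<in>\<Omega>. 1 / sqrt (c * \<mu> x))"
  show "M > 0" unfolding M_def
    by (rule sum_pos) (use finite_domain domain_nonempty measure_pos c_pos in auto)
  show "\<bar>u x\<bar> \<le> M * sqrt (q u u)" if u: "u \<in> H \<Omega>" for u x
  proof (cases "x \<in> \<Omega>")
    case True
    have "\<mu> x * (u x)\<^sup>2 \<le> (\<Sum>x\<in>\<Omega>. \<mu> x * (u x)\<^sup>2)"
      by (rule member_le_sum) (use True finite_domain measure_pos in \<open>auto simp: less_imp_le\<close>)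
    then have "c * (\<mu> x * (u x)\<^sup>2) \<le> q u u"
      using q_coercive[OF u] c_pos by (meson mult_left_mono less_imp_le order_trans)
    then have "sqrt (c * \<mu> x * (u x)\<^sup>2) \<le> sqrt (q u u)" by (simp add: mult.assoc)
    then have "sqrt (c * \<mu> x) * \<bar>u x\<bar> \<le> sqrt (q u u)" by (simp add: real_sqrt_mult)
    then have "\<bar>u x\<bar> \<le> 1 / sqrt (c * \<mu> x) * sqrt (q u u)"
      using True measure_pos c_pos by (simp add: field_simps)
    also have "\<dots> \<le> M * sqrt (q u u)"
      unfolding M_def
      by (rule mult_right_mono[OF member_le_sum])
        (use True finite_domain measure_pos c_pos q_nonneg[OF u] in \<open>auto simp: less_imp_le\<close>)
    finally show ?thesis .
  next
    case False
    then show ?thesis using u \<open>M > 0\<close> q_nonneg[OF u] unfolding H_def by simp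
  qed
qed

lemma pairing_bound:
  obtains K where "K > 0" "\<And>u. u \<in> H \<Omega> \<Longrightarrow> \<bar>pairing g u\<bar> \<le> K * sqrt (q u u)"
proof -
  obtain M where M: "M > 0" "\<And>u x. u \<in> H \<Omega> \<Longrightarrow> \<bar>u x\<bar> \<le> M * sqrt (q u u)"
    using sup_bound by blast
  \<comment> \<open>The summand 1 keeps \<open>K\<close> positive even if \<open>g\<close> vanishes
    on the domain; \<open>K\<close> is a divisor later.\<close>
  define K where "K = (\<Sum>x\<in>\<Omega>. \<mu> x * \<bar>g x\<bar>) * M + 1"
  have S: "0 \<le> (\<Sum>x\<in>\<Omega>. \<mu> x * \<bar>g x\<bar>)"
    using measure_pos by (intro sum_nonneg) (simp add: less_imp_le)
  have "\<bar>pairing g u\<bar> \<le> K * sqrt (q u u)" if u: "u \<in> H \<Omega>" for u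
  proof -
    have "\<bar>pairing g u\<bar> \<le> (\<Sum>x\<in>\<Omega>. \<bar>\<mu> x * (g x * u x)\<bar>)"
      unfolding pairing_def by (rule sum_abs)
    also have "\<dots> \<le> (\<Sum>x\<in>\<Omega>. \<mu> x * \<bar>g x\<bar> * (M * sqrt (q u u)))"
      using M(2)[OF u] measure_pos
      by (intro sum_mono) (auto simp: abs_mult mult.assoc abs_of_pos intro!: mult_left_mono)
    also have "\<dots> = (\<Sum>x\<in>\<Omega>. \<mu> x * \<bar>g x\<bar>) * M * sqrt (q u u)"
      by (simp add: sum_distrib_right mult.assoc)
    also have "\<dots> \<le> K * sqrt (q u u)"
      unfolding K_def using q_nonneg[OF u] by (intro mult_right_mono) auto
    finally show ?thesis .
  qed
  moreover have "K > 0" unfolding K_def using S M(1) by (simp add: add_nonneg_pos)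
  ultimately show ?thesis using that by blast
qed

text \<open>A bound on \<open>q u u\<close> is a uniform bound on all values of \<open>u\<close> by
  \<open>sup_bound\<close>. The set is thus a closed subset of a product of compact intervals, which
  is compact by Tychonoff's theorem.\<close>

lemma compact_bounded_closed:
  assumes "closed S" "S \<subseteq> H \<Omega>" "\<And>u. u \<in> S \<Longrightarrow> q u u \<le> R"
  shows "compact S"
proof -
  obtain M where M: "M > 0" "\<And>u x. u \<in> H \<Omega> \<Longrightarrow> \<bar>u x\<bar> \<le> M * sqrt (q u u)"
    using sup_bound by blast
  define B where "B = (\<Pi>\<^sub>E x\<in>(UNIV::'v set). {- (M * sqrt R) .. M * sqrt R})"
  have "compact B"
    unfolding B_def using compactin_PiE[of "\<lambda>x::'v. euclidean" UNIV "\<lambda>x. {- (M * sqrt R) .. M * sqrt R}"]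
    by (simp add: euclidean_product_topology)
  moreover have "S \<subseteq> B"
  proof
    fix u assume u: "u \<in> S"
    have "\<bar>u x\<bar> \<le> M * sqrt R" for x
    proof -
      have "M * sqrt (q u u) \<le> M * sqrt R" using assms(3)[OF u] M(1) by simp
      then show ?thesis using M(2)[of u x] u assms(2) by fastforce
    qed
    then show "u \<in> B" unfolding B_def by (auto simp: abs_le_iff minus_le_iff)
  qed
  ultimately show ?thesis using assms(1) compact_Int_closed[of B S] by (simp add: Int_absorb1)
qed

lemma closed_H: "closed (H \<Omega>)"
proof -
  have "H \<Omega> = (\<Inter>x\<in>-\<Omega>. {u. u x = 0})" unfolding H_def by auto
  then show ?thesis by (auto intro!: closed_INT closed_Collect_eq continuous_intros)
qed

lemma H_lincomb: "u \<in> H \<Omega> \<Longrightarrow> w \<in> H \<Omega> \<Longrightarrow> (\<lambda>x. a * u x + b * w x) \<in> H \<Omega>"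
  unfolding H_def by simp

lemma small_sphere_barrier:
  obtains r \<epsilon>1 where "r > 0" "\<epsilon>1 > 0"
    "\<And>\<epsilon> u. \<lbrakk>0 < \<epsilon>; \<epsilon> < \<epsilon>1; u \<in> H \<Omega>; q u u = r\<^sup>2\<rbrakk> \<Longrightarrow> denergy (\<lambda>x. \<epsilon> * f x) u u > 0"
proof -
  obtain M where M: "M > 0" "\<And>u x. u \<in> H \<Omega> \<Longrightarrow> \<bar>u x\<bar> \<le> M * sqrt (q u u)"
    using sup_bound by blast
  obtain K where K: "K > 0" "\<And>u. u \<in> H \<Omega> \<Longrightarrow> \<bar>pairing f u\<bar> \<le> K * sqrt (q u u)"
    using pairing_bound by blast
  \<comment> \<open>Chosen so that \<open>(M * r) powr (p - 2) = c / 2\<close>: on the sphere,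
    \<open>sup_bound\<close> and coercivity then give \<open>pmass u \<le> r\<^sup>2 / 2\<close>,
    half of \<open>q u u\<close>.\<close>
  define r where "r = (c / 2) powr (1 / (p - 2)) / M"
  \<comment> \<open>Makes \<open>\<epsilon>1 * (K * r)\<close> the other half, so that the forcing
    term stays strictly below it.\<close>
  define \<epsilon>1 where "\<epsilon>1 = r / (2 * K)"
  have r: "r > 0" unfolding r_def using c_pos M by simp
  have Mr: "(M * r) powr (p - 2) = c / 2"
    unfolding r_def using c_pos M p_gt_2 by (simp add: powr_powr)
  have "denergy (\<lambda>x. \<epsilon> * f x) u u > 0"
    if \<epsilon>: "0 < \<epsilon>" "\<epsilon> < \<epsilon>1" and u: "u \<in> H \<Omega>" "q u u = r\<^sup>2" for \<epsilon> u
  proof -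
    have ux: "\<bar>u x\<bar> \<le> M * r" for x using M(2)[OF u(1)] u(2) r by simp
    have "pmass u \<le> (\<Sum>x\<in>\<Omega>. \<mu> x * (c / 2 * (u x)\<^sup>2))"
      unfolding pmass_def
    proof (intro sum_mono mult_left_mono)
      fix x assume "x \<in> \<Omega>"
      have "\<bar>u x\<bar> powr p = \<bar>u x\<bar> powr (p - 2) * (u x)\<^sup>2"
        using abs_powr_scale_mult[of "u x"] by (simp add: power2_eq_square mult.assoc)
      also have "\<dots> \<le> c / 2 * (u x)\<^sup>2"
        using powr_mono2[OF _ _ ux, of "p - 2" x] p_gt_2 Mr by (intro mult_right_mono) auto
      finally show "\<bar>u x\<bar> powr p \<le> c / 2 * (u x)\<^sup>2" .
    qed (use measure_pos in \<open>auto simp: less_imp_le\<close>)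
    also have "\<dots> = c * (\<Sum>x\<in>\<Omega>. \<mu> x * (u x)\<^sup>2) / 2"
      by (simp add: sum_distrib_left sum_divide_distrib algebra_simps)
    also have "\<dots> \<le> r\<^sup>2 / 2" using q_coercive[OF u(1)] u(2) by simp
    finally have P: "pmass u \<le> r\<^sup>2 / 2" .
    have "pairing (\<lambda>x. \<epsilon> * f x) u = \<epsilon> * pairing f u"
      unfolding pairing_def by (simp add: sum_distrib_left algebra_simps)
    also have "\<dots> \<le> \<epsilon> * (K * r)"
      using K(2)[OF u(1)] u(2) r \<epsilon> by (intro mult_left_mono) auto
    also have "\<dots> < \<epsilon>1 * (K * r)" using \<epsilon> K r by simp
    also have "\<dots> = r\<^sup>2 / 2" unfolding \<epsilon>1_def using K by (simp add: power2_eq_square)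
    finally show ?thesis using P u(2) unfolding denergy_self by linarith
  qed
  moreover have "\<epsilon>1 > 0" unfolding \<epsilon>1_def using r K by simp
  ultimately show ?thesis using that r by blast
qed

section \<open>The first critical point, inside the ball\<close>

text \<open>Since \<open>w\<close> may be replaced by its negative, absence of a descent direction
  already forces the derivative to vanish.\<close>

lemma criticalI:
  assumes "u \<in> H \<Omega>" "\<And>w. w \<in> H \<Omega> \<Longrightarrow> \<not> denergy g u w < 0"
  shows "critical g u"
  unfolding critical_def
proof (intro conjI ballI assms(1))
  fix w assume w: "w \<in> H \<Omega>"
  then have "(\<lambda>x. - w x) \<in> H \<Omega>" unfolding H_def by simp
  then show "denergy g u w = 0"
    using assms(2)[OF w] assms(2)[of "\<lambda>x. - w x"] by (simp add: denergy_minus)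
qed

lemma energy_decrease:
  assumes "denergy g u w < 0"
  obtains d where "d > 0" "\<And>s. 0 < s \<Longrightarrow> s < d \<Longrightarrow> energy g (\<lambda>x. u x + s * w x) < energy g u"
  using DERIV_neg_dec_right[OF DERIV_energy_line[of g u w 0]] assms by auto

lemma critical_inside:
  assumes r: "r > 0" and barrier: "\<And>u. u \<in> H \<Omega> \<Longrightarrow> q u u = r\<^sup>2 \<Longrightarrow> denergy g u u > 0"
  obtains u where "critical g u" "q u u < r\<^sup>2"
proof -
  define S where "S = H \<Omega> \<inter> {u. q u u \<le> r\<^sup>2}"
  have "closed S" unfolding S_def
    by (intro closed_Int closed_H closed_Collect_le q_cont continuous_intros)
  then have "compact S" by (rule compact_bounded_closed) (auto simp: S_def)
  moreover have "(\<lambda>x. 0) \<in> S"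
    using q_scale_self[of 0 "\<lambda>x. 0"] unfolding S_def H_def by simp
  ultimately obtain u where u: "u \<in> S" and min: "\<And>v. v \<in> S \<Longrightarrow> energy g u \<le> energy g v"
    using continuous_attains_inf[of S "energy g"] continuous_on_subset[OF continuous_energy, of S]
    by auto
  have uH: "u \<in> H \<Omega>" and ur: "q u u \<le> r\<^sup>2" using u unfolding S_def by auto
  have lt: "q u u < r\<^sup>2"
  proof (rule ccontr)
    assume "\<not> q u u < r\<^sup>2"
    then have eq: "q u u = r\<^sup>2" using ur by simp
    \<comment> \<open>On the sphere the barrier makes the inward radial direction one of descent,
      and moving inward does not leave the ball.\<close>
    have "denergy g u (\<lambda>x. - u x) < 0" using barrier[OF uH eq] by (simp add: denergy_minus)
    then obtain d where d: "d > 0"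
      "\<And>s. 0 < s \<Longrightarrow> s < d \<Longrightarrow> energy g (\<lambda>x. u x + s * - u x) < energy g u"
      using energy_decrease by metis
    \<comment> \<open>The cap at 1 keeps \<open>1 - s\<close> in the unit interval, so that scaling
      by it does not increase \<open>q\<close>.\<close>
    define s where "s = min (d / 2) 1"
    have s: "0 < s" "s < d" "s \<le> 1" unfolding s_def using d(1) by auto
    have v: "(\<lambda>x. u x + s * - u x) = (\<lambda>x. (1 - s) * u x)" by (simp add: algebra_simps)
    have "(1 - s)\<^sup>2 \<le> 1" using s by (simp add: abs_square_le_1)
    then have "(1 - s)\<^sup>2 * r\<^sup>2 \<le> r\<^sup>2" by (simp add: mult_left_le_one_le)
    then have "(\<lambda>x. (1 - s) * u x) \<in> S"
      using uH unfolding S_def by (auto simp: q_scale_self eq H_def)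
    then show False using min d(2)[OF s(1,2)] v by fastforce
  qed
  have "critical g u"
  proof (rule criticalI[OF uH])
    fix w assume w: "w \<in> H \<Omega>"
    show "\<not> denergy g u w < 0"
    proof
      assume "denergy g u w < 0"
      then obtain d where d: "d > 0"
        "\<And>s. 0 < s \<Longrightarrow> s < d \<Longrightarrow> energy g (\<lambda>x. u x + s * w x) < energy g u"
        using energy_decrease by metis
      \<comment> \<open>This polynomial is \<open>q\<close> along \<open>u + s w\<close>. By the
        strict inequality \<open>lt\<close>, small steps in any direction stay in the ball.\<close>
      have "((\<lambda>s. q u u + 2 * s * q u w + s\<^sup>2 * q w w) \<longlongrightarrow> q u u + 2 * 0 * q u w + 0\<^sup>2 * q w w)
          (at_right 0)"
        by (intro tendsto_intros)
      then have "\<forall>\<^sub>F s in at_right 0. q u u + 2 * s * q u w + s\<^sup>2 * q w w < r\<^sup>2"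
        by (rule order_tendstoD(2)) (use lt in simp)
      moreover have "\<forall>\<^sub>F s in at_right 0. s \<in> {0<..<d}"
        using d(1) by (rule eventually_at_right_real)
      ultimately have "\<forall>\<^sub>F s in at_right 0. (\<lambda>x. u x + s * w x) \<in> S \<and> s \<in> {0<..<d}"
      proof eventually_elim
        case (elim s)
        then show ?case
          using H_lincomb[OF uH w, of 1 s] q_lincomb_self[of 1 u s w] unfolding S_def by simp
      qed
      then obtain s where "(\<lambda>x. u x + s * w x) \<in> S" "s \<in> {0<..<d}"
        using eventually_happens'[of "at_right (0::real)"] by auto
      then show False using min d(2) by fastforce
    qed
  qed
  then show ?thesis using lt that by blast
qed

section \<open>Rays and the Nehari set\<close>

lemma pmass_nonneg: "0 \<le> pmass u"
  unfolding pmass_def using measure_pos by (intro sum_nonneg) (simp add: less_imp_le)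

text \<open>
  Up to the factor \<open>t\<close>, the function \<open>t \<mapsto> J'(tu)(tu)\<close> is concave; it vanishes at \<open>1\<close> and is positive
  where the ray crosses the sphere, at \<open>t1 < 1\<close>.
\<close>

lemma ray_profile:
  assumes r: "r > 0" and barrier: "\<And>u. u \<in> H \<Omega> \<Longrightarrow> q u u = r\<^sup>2 \<Longrightarrow> denergy g u u > 0"
    and u: "u \<in> H \<Omega>" and big: "q u u > r\<^sup>2" and zero: "denergy g u u = 0"
  defines "t1 \<equiv> r / sqrt (q u u)"
  shows "0 < t1" "t1 < 1"
    "\<And>t. t1 < t \<Longrightarrow> t < 1 \<Longrightarrow> denergy g (\<lambda>x. t * u x) (\<lambda>x. t * u x) > 0"
    "\<And>t. 1 < t \<Longrightarrow> denergy g (\<lambda>x. t * u x) (\<lambda>x. t * u x) < 0"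
proof -
  have Q: "q u u > 0" using big r by (smt (verit) zero_le_power2)
  show t1: "0 < t1" using Q r unfolding t1_def by simp
  have "r < sqrt (q u u)" using big real_less_rsqrt by blast
  then show t1': "t1 < 1" using Q r unfolding t1_def by simp
  define \<psi> where "\<psi> = (\<lambda>t. q u u * t - pmass u * t powr (p - 1) - pairing g u)"
  have ray: "denergy g (\<lambda>x. t * u x) (\<lambda>x. t * u x) = t * \<psi> t" if "t > 0" for t
    using denergy_ray[OF that] unfolding \<psi>_def by simp
  have conc: "(1 - \<theta>) * \<psi> s + \<theta> * \<psi> t \<le> \<psi> ((1 - \<theta>) * s + \<theta> * t)"
    if "s > 0" "t > 0" "0 \<le> \<theta>" "\<theta> \<le> 1" for s t \<theta>
    unfolding \<psi>_def using concave_line_power[of "p - 1" "pmass u" t s \<theta>] that p_gt_2 pmass_nonneg by simp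
  have z: "\<psi> 1 = 0" using ray[of 1] zero by simp
  have "t1\<^sup>2 * q u u = r\<^sup>2" unfolding t1_def using Q by (simp add: power_divide)
  then have "t1 * \<psi> t1 > 0"
    using barrier[of "\<lambda>x. t1 * u x"] u ray[OF t1] by (simp add: q_scale_self H_def)
  then have pos: "\<psi> t1 > 0" using t1 by (simp add: zero_less_mult_iff)
  show "denergy g (\<lambda>x. t * u x) (\<lambda>x. t * u x) > 0" if t: "t1 < t" "t < 1" for t
  proof -
    \<comment> \<open>Here \<open>t\<close> is a convex combination of \<open>t1\<close> and 1,
      where \<psi> is positive and zero respectively.\<close>
    define \<theta> where "\<theta> = (t - t1) / (1 - t1)"
    have \<theta>: "0 \<le> \<theta>" "\<theta> < 1" unfolding \<theta>_def using t t1' by auto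
    have "\<theta> * (1 - t1) = t - t1" unfolding \<theta>_def using t1' by simp
    then have e: "(1 - \<theta>) * t1 + \<theta> * 1 = t" by (simp add: algebra_simps)
    have "0 < (1 - \<theta>) * \<psi> t1" using \<theta> pos by simp
    then have "\<psi> t > 0" using conc[of t1 1 \<theta>] \<theta> t1 z unfolding e by simp
    then show ?thesis using ray[of t] t t1 by simp
  qed
  show "denergy g (\<lambda>x. t * u x) (\<lambda>x. t * u x) < 0" if t: "1 < t" for t
  proof -
    \<comment> \<open>Now 1 is the convex combination, of \<open>t1\<close> and \<open>t\<close>. As
      \<psi> vanishes at 1 and is positive at \<open>t1\<close>, concavity forces it to be negative
      at \<open>t\<close>.\<close>
    define \<theta> where "\<theta> = (1 - t1) / (t - t1)"
    have \<theta>: "0 < \<theta>" "\<theta> < 1" unfolding \<theta>_def using t t1' by auto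
    have "\<theta> * (t - t1) = 1 - t1" unfolding \<theta>_def using t t1' by simp
    then have e: "(1 - \<theta>) * t1 + \<theta> * t = 1" by (simp add: algebra_simps)
    have "0 < (1 - \<theta>) * \<psi> t1" using \<theta> pos by simp
    then have "\<theta> * \<psi> t < 0" using conc[of t1 t \<theta>] \<theta> t1 t z unfolding e by simp
    then have "\<psi> t < 0" using \<theta> by (simp add: mult_less_0_iff)
    then show ?thesis using ray[of t] t by (simp add: mult_less_0_iff)
  qed
qed

text \<open>Along the ray through a point mass the radial derivative is positive on the sphere, but
  far out the power \<open>p > 2\<close> outweighs the quadratic and linear terms. The intermediate
  value theorem gives a zero in between.\<close>

lemma nehari_nonempty:
  assumes r: "r > 0" and barrier: "\<And>u. u \<in> H \<Omega> \<Longrightarrow> q u u = r\<^sup>2 \<Longrightarrow> denergy g u u > 0"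
  obtains u where "u \<in> H \<Omega>" "r\<^sup>2 \<le> q u u" "denergy g u u = 0"
proof -
  obtain x0 where x0: "x0 \<in> \<Omega>" using domain_nonempty by blast
  define v where "v = (\<lambda>x. if x = x0 then 1 else 0 :: real)"
  have vH: "v \<in> H \<Omega>" unfolding v_def H_def using x0 by auto
  have "0 < (\<Sum>x\<in>\<Omega>. \<mu> x * (v x)\<^sup>2)"
    by (rule sum_pos2[OF finite_domain x0]) (use measure_pos x0 in \<open>auto simp: v_def less_imp_le\<close>)
  then have Q: "q v v > 0" using q_coercive[OF vH] c_pos by (smt (verit) mult_pos_pos)
  have P: "pmass v > 0" unfolding pmass_def
    by (rule sum_pos2[OF finite_domain x0]) (use measure_pos x0 in \<open>auto simp: v_def less_imp_le\<close>)
  define t1 where "t1 = r / sqrt (q v v)"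
  have t1: "t1 > 0" unfolding t1_def using r Q by simp
  have t1q: "t1\<^sup>2 * q v v = r\<^sup>2" unfolding t1_def using Q by (simp add: power_divide)
  \<comment> \<open>Once \<open>t2 powr (p - 2) \<ge> T\<close>, the power term at \<open>t2\<close>
    dominates \<open>t2 * (q v v + \<bar>pairing g v\<bar>)\<close>; \<open>t2 \<ge> 1\<close> then
    covers the unscaled pairing.\<close>
  define T where "T = (q v v + \<bar>pairing g v\<bar>) / pmass v"
  have T: "T \<ge> 0" unfolding T_def using Q P by simp
  define t2 where "t2 = max (max 1 t1) (T powr (1 / (p - 2)))"
  have t2: "t2 \<ge> 1" "t2 \<ge> t1" "t2 \<ge> T powr (1 / (p - 2))" unfolding t2_def by auto
  have "T = (T powr (1 / (p - 2))) powr (p - 2)" using T p_gt_2 by (simp add: powr_powr)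
  also have "\<dots> \<le> t2 powr (p - 2)" using t2 p_gt_2 by (intro powr_mono2) auto
  finally have "pmass v * T \<le> pmass v * t2 powr (p - 2)" using P by simp
  then have "q v v + \<bar>pairing g v\<bar> \<le> pmass v * t2 powr (p - 2)" unfolding T_def using P by simp
  then have "t2 * (q v v + \<bar>pairing g v\<bar>) \<le> t2 * (pmass v * t2 powr (p - 2))"
    using t2 by (intro mult_left_mono) auto
  also have "\<dots> = pmass v * t2 powr (p - 1)"
    using t2 powr_mult_base[of t2 "p - 2"] by (simp add: mult.left_commute)
  finally have "q v v * t2 + t2 * \<bar>pairing g v\<bar> \<le> pmass v * t2 powr (p - 1)"
    by (simp add: algebra_simps)
  moreover have "\<bar>pairing g v\<bar> \<le> t2 * \<bar>pairing g v\<bar>" using t2 mult_right_mono[of 1 t2 "\<bar>pairing g v\<bar>"] by simp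
  ultimately have "q v v * t2 - pmass v * t2 powr (p - 1) - pairing g v \<le> 0" by linarith
  then have neg: "denergy g (\<lambda>x. t2 * v x) (\<lambda>x. t2 * v x) \<le> 0"
    using t2 denergy_ray[of t2 g v] by (simp add: mult_nonneg_nonpos)
  have pos: "denergy g (\<lambda>x. t1 * v x) (\<lambda>x. t1 * v x) > 0"
    using vH barrier[of "\<lambda>x. t1 * v x"] by (simp add: q_scale_self t1q H_def)
  have "continuous_on UNIV (\<lambda>t. denergy g (\<lambda>x. t * v x) (\<lambda>x. t * v x))"
    using continuous_on_compose2[OF continuous_denergy_self_lincomb, of UNIV "\<lambda>t. (t, 0)" g v v]
    by (simp add: continuous_on_Pair)
  then have "continuous_on {t1..t2} (\<lambda>t. denergy g (\<lambda>x. t * v x) (\<lambda>x. t * v x))"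
    by (rule continuous_on_subset) simp
  then obtain t where t: "t1 \<le> t" "denergy g (\<lambda>x. t * v x) (\<lambda>x. t * v x) = 0"
    using IVT2'[of "\<lambda>t. denergy g (\<lambda>x. t * v x) (\<lambda>x. t * v x)" t2 0 t1] neg pos t2(2) by auto
  have "t1\<^sup>2 \<le> t\<^sup>2" using t t1 by (intro power_mono) auto
  then have "r\<^sup>2 \<le> q (\<lambda>x. t * v x) (\<lambda>x. t * v x)"
    using Q unfolding q_scale_self t1q[symmetric] by (intro mult_right_mono) auto
  then show ?thesis using that[of "\<lambda>x. t * v x"] t vH by (simp add: H_def)
qed

text \<open>The Nehari condition eliminates \<open>pmass\<close>. The remaining quadratic
  coefficient is positive as \<open>p > 2\<close>, which makes the energy coercive on the Nehari
  set.\<close>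

lemma nehari_energy:
  assumes "denergy g u u = 0"
  shows "energy g u = (1 / 2 - 1 / p) * q u u - (1 - 1 / p) * pairing g u"
proof -
  have "pmass u = q u u - pairing g u" using assms unfolding denergy_self by simp
  then show ?thesis
    unfolding energy_def by (simp add: diff_divide_distrib left_diff_distrib)
qed

text \<open>With \<open>y = sqrt (q u u)\<close>, \<open>nehari_energy\<close> and
  \<open>pairing_bound\<close> give \<open>a * y\<^sup>2 \<le> \<bar>e\<bar> + K * y\<close>, and a
  quadratic dominated by a linear function bounds \<open>y\<close>.\<close>

lemma nehari_sublevel_bounded:
  obtains R where "\<And>u. \<lbrakk>u \<in> H \<Omega>; denergy g u u = 0; energy g u \<le> e\<rbrakk> \<Longrightarrow> q u u \<le> R"
proof -
  obtain K where K: "K > 0" "\<And>u. u \<in> H \<Omega> \<Longrightarrow> \<bar>pairing g u\<bar> \<le> K * sqrt (q u u)"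
    using pairing_bound by blast
  define a where "a = 1 / 2 - 1 / p"
  have a: "a > 0" unfolding a_def using p_gt_2 by (simp add: field_simps)
  have "q u u \<le> (1 + (\<bar>e\<bar> + K) / a)\<^sup>2"
    if u: "u \<in> H \<Omega>" "denergy g u u = 0" "energy g u \<le> e" for u
  proof -
    define y where "y = sqrt (q u u)"
    have y: "y \<ge> 0" "q u u = y\<^sup>2" unfolding y_def using q_nonneg[OF u(1)] by auto
    have "(1 - 1 / p) * pairing g u \<le> \<bar>(1 - 1 / p) * pairing g u\<bar>" by simp
    also have "\<dots> \<le> 1 * \<bar>pairing g u\<bar>"
      unfolding abs_mult using p_gt_2 by (intro mult_right_mono) auto
    finally have "(1 - 1 / p) * pairing g u \<le> K * y"
      using K(2)[OF u(1)] unfolding y_def by linarith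
    moreover have "a * y\<^sup>2 - (1 - 1 / p) * pairing g u \<le> e"
      using u(3) unfolding nehari_energy[OF u(2)] y(2) a_def .
    ultimately have "a * y\<^sup>2 \<le> \<bar>e\<bar> + K * y" by linarith
    have "y \<le> 1 + (\<bar>e\<bar> + K) / a"
    proof (cases "y \<le> 1")
      case True
      have "0 \<le> (\<bar>e\<bar> + K) / a" using a K(1) by simp
      then show ?thesis using True by linarith
    next
      case False
      then have "\<bar>e\<bar> * 1 \<le> \<bar>e\<bar> * y" by (intro mult_left_mono) auto
      then have "y * (a * y) \<le> y * (\<bar>e\<bar> + K)"
        using \<open>a * y\<^sup>2 \<le> \<bar>e\<bar> + K * y\<close> by (simp add: power2_eq_square algebra_simps)
      then have "a * y \<le> \<bar>e\<bar> + K" using False by simp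
      then have "y \<le> (\<bar>e\<bar> + K) / a" using a by (simp add: field_simps)
      then show ?thesis by simp
    qed
    then show ?thesis unfolding y(2) using y(1) by (intro power_mono) auto
  qed
  then show ?thesis using that by blast
qed

lemma nehari_minimizer:
  assumes r: "r > 0" and barrier: "\<And>u. u \<in> H \<Omega> \<Longrightarrow> q u u = r\<^sup>2 \<Longrightarrow> denergy g u u > 0"
  obtains u where "u \<in> H \<Omega>" "r\<^sup>2 \<le> q u u" "denergy g u u = 0"
    "\<And>v. \<lbrakk>v \<in> H \<Omega>; r\<^sup>2 \<le> q v v; denergy g v v = 0\<rbrakk> \<Longrightarrow> energy g u \<le> energy g v"
proof -
  obtain u0 where u0: "u0 \<in> H \<Omega>" "r\<^sup>2 \<le> q u0 u0" "denergy g u0 u0 = 0"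
    using nehari_nonempty[OF r barrier] by blast
  obtain R where R: "\<And>u. \<lbrakk>u \<in> H \<Omega>; denergy g u u = 0; energy g u \<le> energy g u0\<rbrakk> \<Longrightarrow> q u u \<le> R"
    using nehari_sublevel_bounded by blast
  \<comment> \<open>Cutting off at the energy of \<open>u0\<close> makes the set compact without
    changing the minimum. The non-strict bound by \<open>r\<^sup>2\<close> keeps it closed.\<close>
  define S where "S = H \<Omega> \<inter> {u. r\<^sup>2 \<le> q u u} \<inter> {u. denergy g u u = 0} \<inter> {u. energy g u \<le> energy g u0}"
  have "closed S" unfolding S_def
    by (intro closed_Int closed_H closed_Collect_le closed_Collect_eq q_cont
        continuous_denergy_self continuous_energy continuous_on_const)
  then have "compact S" by (rule compact_bounded_closed) (auto simp: S_def intro: R)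
  moreover have "u0 \<in> S" using u0 unfolding S_def by simp
  ultimately obtain u where u: "u \<in> S" and min: "\<And>v. v \<in> S \<Longrightarrow> energy g u \<le> energy g v"
    using continuous_attains_inf[of S "energy g"] continuous_on_subset[OF continuous_energy, of S]
    by auto
  have "energy g u \<le> energy g v" if "v \<in> H \<Omega>" "r\<^sup>2 \<le> q v v" "denergy g v v = 0" for v
    using min[of v] min[OF \<open>u0 \<in> S\<close>] that unfolding S_def by (cases "energy g v \<le> energy g u0") auto
  then show ?thesis using that u unfolding S_def by blast
qed

text \<open>Translates the signs in \<open>ray_profile\<close> into monotonicity of the energy along
  the ray.\<close>

lemma DERIV_energy_ray:
  assumes "t > 0"
  shows "((\<lambda>t. energy g (\<lambda>x. t * u x)) has_real_derivative
     denergy g (\<lambda>x. t * u x) (\<lambda>x. t * u x) / t) (at t)"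
proof -
  have "q (\<lambda>x. t * u x) (\<lambda>x. t * u x) = t * q (\<lambda>x. t * u x) u"
    using q_lincomb[of t u 0 u "\<lambda>x. t * u x"] q_sym[of u "\<lambda>x. t * u x"] by simp
  then have "denergy g (\<lambda>x. t * u x) (\<lambda>x. t * u x) / t = denergy g (\<lambda>x. t * u x) u"
    unfolding denergy_def pairing_scale
    using assms by (simp add: sum_divide_distrib diff_divide_distrib mult_ac)
  then show ?thesis using DERIV_energy_line[of g "\<lambda>x. 0" u t] by simp
qed

section \<open>The second critical point, outside the ball\<close>

lemma critical_outside:
  assumes r: "r > 0" and barrier: "\<And>u. u \<in> H \<Omega> \<Longrightarrow> q u u = r\<^sup>2 \<Longrightarrow> denergy g u u > 0"
  obtains u where "critical g u" "r\<^sup>2 < q u u"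
proof -
  obtain u where u: "u \<in> H \<Omega>" "r\<^sup>2 \<le> q u u" "denergy g u u = 0"
    and min: "\<And>v. \<lbrakk>v \<in> H \<Omega>; r\<^sup>2 \<le> q v v; denergy g v v = 0\<rbrakk> \<Longrightarrow> energy g u \<le> energy g v"
    using nehari_minimizer[OF r barrier] by blast
  \<comment> \<open>Equality would put \<open>u\<close> on the sphere, where the barrier contradicts
    the Nehari condition.\<close>
  have big: "r\<^sup>2 < q u u" using u barrier[OF u(1)] by force
  define t1 where "t1 = r / sqrt (q u u)"
  have ray: "0 < t1" "t1 < 1"
    "\<And>t. t1 < t \<Longrightarrow> t < 1 \<Longrightarrow> denergy g (\<lambda>x. t * u x) (\<lambda>x. t * u x) > 0"
    "\<And>t. 1 < t \<Longrightarrow> denergy g (\<lambda>x. t * u x) (\<lambda>x. t * u x) < 0"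
    using ray_profile[OF r _ u(1) big u(3)] barrier unfolding t1_def by blast+
  have cont: "continuous_on A (\<lambda>t. energy g (\<lambda>x. t * u x))" for A
    by (rule continuous_on_compose2[OF continuous_energy])
      (auto intro!: continuous_on_coordinatewise_then_product continuous_intros)
  have ray_max: "energy g (\<lambda>x. t * u x) \<le> energy g u" if "t1 < t" for t
  proof (cases t "1::real" rule: linorder_cases)
    case less
    have "energy g (\<lambda>x. t * u x) < energy g (\<lambda>x. 1 * u x)"
    proof (rule DERIV_pos_imp_increasing_open[OF less])
      fix s assume s: "t < s" "s < 1"
      show "\<exists>y. ((\<lambda>t. energy g (\<lambda>x. t * u x)) has_real_derivative y) (at s) \<and> y > 0"
        using DERIV_energy_ray[of s g u] ray(3)[of s] s that ray(1) by fastforce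
    qed (rule cont)
    then show ?thesis by simp
  next
    case greater
    have "energy g (\<lambda>x. 1 * u x) > energy g (\<lambda>x. t * u x)"
    proof (rule DERIV_neg_imp_decreasing_open[OF greater])
      fix s assume s: "1 < s" "s < t"
      show "\<exists>y. ((\<lambda>t. energy g (\<lambda>x. t * u x)) has_real_derivative y) (at s) \<and> y < 0"
        using DERIV_energy_ray[of s g u] ray(4)[of s] s by (fastforce simp: divide_neg_pos)
    qed (rule cont)
    then show ?thesis by simp
  qed simp
  have "critical g u"
  proof (rule criticalI[OF u(1)])
    fix w assume w: "w \<in> H \<Omega>"
    define z where "z = (\<lambda>t s x. t * u x + s * w x)"
    have zH: "z t s \<in> H \<Omega>" for t s unfolding z_def by (rule H_lincomb[OF u(1) w])
    have z0: "z t 0 = (\<lambda>x. t * u x)" for t unfolding z_def by simp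
    show "\<not> denergy g u w < 0"
    proof
      assume neg: "denergy g u w < 0"
      \<comment> \<open>Two open conditions that hold at (1, 0): \<open>w\<close> is still a descent
        direction, and the function is still outside the ball. They persist on a rectangle around
        (1, 0).\<close>
      define A where "A = {y::real \<times> real. denergy g (z (fst y) (snd y)) w < 0}
        \<inter> {y. r\<^sup>2 < q (z (fst y) (snd y)) (z (fst y) (snd y))}"
      have "open A"
        unfolding A_def z_def
        by (intro open_Int open_Collect_less continuous_denergy_lincomb continuous_q_lincomb
            continuous_on_const)
      moreover have "(1, 0) \<in> A" using neg big unfolding A_def z_def by simp
      ultimately obtain U V where UV: "open U" "open V" "1 \<in> U" "0 \<in> V" "U \<times> V \<subseteq> A"
        by (elim open_prod_elim) auto
      obtain d where d: "d > 0" "ball 1 d \<subseteq> U" using UV open_contains_ball by blast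
      obtain d' where d': "d' > 0" "ball 0 d' \<subseteq> V" using UV open_contains_ball by blast
      \<comment> \<open>Keeps both endpoints \<open>1 - \<delta>\<close> and
        \<open>1 + \<delta>\<close> in the rectangle and to the right of \<open>t1\<close>, where
        the signs along the ray are known.\<close>
      obtain \<delta> where "\<delta> > 0" "\<delta> < min d (1 - t1)"
        using dense[of 0 "min d (1 - t1)"] d(1) ray(2) by auto
      then have \<delta>: "\<delta> > 0" "\<delta> < d" "t1 < 1 - \<delta>" by auto
      have inA: "denergy g (z t s) w < 0" "r\<^sup>2 < q (z t s) (z t s)"
        if "1 - \<delta> \<le> t" "t \<le> 1 + \<delta>" "0 \<le> s" "s < d'" for t s
      proof -
        have "t \<in> U" using d \<delta> that by (auto simp: dist_real_def)
        moreover have "s \<in> V" using d' that by (auto simp: dist_real_def)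
        ultimately have "(t, s) \<in> A" using UV(5) by blast
        then show "denergy g (z t s) w < 0" "r\<^sup>2 < q (z t s) (z t s)" unfolding A_def by auto
      qed
      have cont_s: "continuous_on UNIV (\<lambda>s. denergy g (z t s) (z t s))" for t
        using continuous_on_compose2[OF continuous_denergy_self_lincomb, of UNIV "\<lambda>s. (t, s)" g u w]
        unfolding z_def by (simp add: continuous_on_Pair)
      have cont_t: "continuous_on UNIV (\<lambda>t. denergy g (z t s) (z t s))" for s
        using continuous_on_compose2[OF continuous_denergy_self_lincomb, of UNIV "\<lambda>t. (t, s)" g u w]
        unfolding z_def by (simp add: continuous_on_Pair)
      have lim: "((\<lambda>s. denergy g (z t s) (z t s)) \<longlongrightarrow> denergy g (z t 0) (z t 0)) (at_right 0)" for t
        using cont_s[of t] by (auto simp: continuous_on_def intro: tendsto_within_subset)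
      \<comment> \<open>The opposite signs of the radial derivative at the two endpoints survive a
        small shift by \<open>s w\<close>; this sets up the intermediate value theorem in
        \<open>t\<close>.\<close>
      have "\<forall>\<^sub>F s in at_right 0. denergy g (z (1 - \<delta>) s) (z (1 - \<delta>) s) > 0"
        by (rule order_tendstoD(1)[OF lim]) (use ray(3) \<delta> in \<open>simp add: z0\<close>)
      moreover have "\<forall>\<^sub>F s in at_right 0. denergy g (z (1 + \<delta>) s) (z (1 + \<delta>) s) < 0"
        by (rule order_tendstoD(2)[OF lim]) (use ray(4) \<delta> in \<open>simp add: z0\<close>)
      moreover have "\<forall>\<^sub>F s in at_right 0. s \<in> {0<..<d'}"
        using d'(1) by (rule eventually_at_right_real)
      ultimately have "\<forall>\<^sub>F s in at_right 0. denergy g (z (1 - \<delta>) s) (z (1 - \<delta>) s) > 0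
          \<and> denergy g (z (1 + \<delta>) s) (z (1 + \<delta>) s) < 0 \<and> s \<in> {0<..<d'}"
        by eventually_elim simp
      then obtain s where s: "denergy g (z (1 - \<delta>) s) (z (1 - \<delta>) s) > 0"
        "denergy g (z (1 + \<delta>) s) (z (1 + \<delta>) s) < 0" "0 < s" "s < d'"
        using eventually_happens'[of "at_right (0::real)"] by auto
      obtain t where t: "1 - \<delta> \<le> t" "t \<le> 1 + \<delta>" "denergy g (z t s) (z t s) = 0"
        using IVT2'[of "\<lambda>t. denergy g (z t s) (z t s)" "1 + \<delta>" 0 "1 - \<delta>"] s \<delta>
          continuous_on_subset[OF cont_t] by auto
      \<comment> \<open>The descent starts at \<open>t u\<close> rather than at \<open>u\<close>,
        with \<open>t\<close> fixed by the intermediate value theorem; \<open>ray_max\<close>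
        compares that starting point with \<open>u\<close>.\<close>
      have "energy g (z t s) < energy g (z t 0)"
      proof (rule DERIV_neg_imp_decreasing[OF s(3)])
        fix a assume "0 \<le> a" "a \<le> s"
        then have "denergy g (z t a) w < 0" using inA(1)[OF t(1,2)] s(4) by simp
        then show "\<exists>y. ((\<lambda>s. energy g (z t s)) has_real_derivative y) (at a) \<and> y < 0"
          using DERIV_energy_line[of g "\<lambda>x. t * u x" w a] unfolding z_def by blast
      qed
      also have "\<dots> \<le> energy g u" unfolding z0 by (rule ray_max) (use t \<delta> in simp)
      also have "\<dots> \<le> energy g (z t s)"
        using inA(2)[OF t(1,2)] s t(3) by (intro min zH) (auto intro: less_imp_le)
      finally show False by simp
    qed
  qed
  then show ?thesis using big that by blast
qed

section \<open>Two distinct critical points, and the return to the graph\<close>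

theorem two_critical_points:
  obtains \<epsilon>1 where "\<epsilon>1 > 0"
    "\<And>\<epsilon>. \<lbrakk>0 < \<epsilon>; \<epsilon> < \<epsilon>1\<rbrakk> \<Longrightarrow> \<exists>u v. u \<noteq> v \<and> critical (\<lambda>x. \<epsilon> * f x) u \<and> critical (\<lambda>x. \<epsilon> * f x) v"
proof -
  obtain r \<epsilon>1 where r: "r > 0" "\<epsilon>1 > 0"
    "\<And>\<epsilon> u. \<lbrakk>0 < \<epsilon>; \<epsilon> < \<epsilon>1; u \<in> H \<Omega>; q u u = r\<^sup>2\<rbrakk> \<Longrightarrow> denergy (\<lambda>x. \<epsilon> * f x) u u > 0"
    using small_sphere_barrier by blast
  have "\<exists>u v. u \<noteq> v \<and> critical (\<lambda>x. \<epsilon> * f x) u \<and> critical (\<lambda>x. \<epsilon> * f x) v"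
    if \<epsilon>: "0 < \<epsilon>" "\<epsilon> < \<epsilon>1" for \<epsilon>
  proof -
    obtain u where "critical (\<lambda>x. \<epsilon> * f x) u" "q u u < r\<^sup>2"
      using critical_inside[OF r(1) r(3)[OF \<epsilon>]] by blast
    moreover obtain v where "critical (\<lambda>x. \<epsilon> * f x) v" "r\<^sup>2 < q v v"
      using critical_outside[OF r(1) r(3)[OF \<epsilon>]] by blast
    \<comment> \<open>The two are distinct because \<open>q\<close> takes values on different sides
      of \<open>r\<^sup>2\<close>.\<close>
    ultimately show ?thesis by force
  qed
  then show ?thesis using r(2) that by blast
qed

end


theorem theorem1p1:
  fixes E :: "('v \<times> 'v) set" and \<omega> :: "'v \<Rightarrow> 'v \<Rightarrow> real" and \<mu> :: "'v \<Rightarrow> real"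
    and \<Omega> :: "'v set" and p lam :: real and f :: "'v \<Rightarrow> real"
  assumes "weighted_graph E \<omega> \<mu>"
    and "bounded_domain E \<Omega>"
    and "p > 2"
    and "0 < lam" and "lam < lambda1 E \<omega> \<mu> \<Omega>"
    and "f \<in> H_dual E \<omega> \<mu> \<Omega>"
  shows "\<exists>\<epsilon>1>0. \<forall>\<epsilon>. 0 < \<epsilon> \<and> \<epsilon> < \<epsilon>1 \<longrightarrow>
           (\<exists>u v. u \<noteq> v \<and> weak_solution E \<omega> \<mu> \<Omega> lam p \<epsilon> f u \<and> weak_solution E \<omega> \<mu> \<Omega> lam p \<epsilon> f v)"
proof -
  interpret weighted_graph E \<omega> \<mu> by fact
  define S where "S = \<Omega> \<union> boundary E \<Omega>"
  define q where "q = (\<lambda>u w. graph_integral \<mu> S (\<lambda>x. laplacian E \<omega> \<mu> u x * laplacian E \<omega> \<mu> w x)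
     - lam * graph_integral \<mu> \<Omega> (\<lambda>x. u x * w x))"
  have fin: "finite \<Omega>" using finite_bounded_domain[OF assms(2)] .
  interpret power_functional \<Omega> \<mu> q "lambda1 E \<omega> \<mu> \<Omega> - lam" p
  proof
    show "finite \<Omega>" by (fact fin)
    show "\<Omega> \<noteq> {}" using assms(2) unfolding bounded_domain_def by simp
    show "q (\<lambda>x. a * u x + b * w x) \<phi> = a * q u \<phi> + b * q w \<phi>" for a b u w \<phi>
      unfolding q_def graph_integral_def laplacian_lincomb
      by (simp add: algebra_simps sum.distrib sum_distrib_left)
    show "q u w = q w u" for u w unfolding q_def by (simp add: mult.commute)
    show "continuous_on UNIV (\<lambda>u. q u u)"
      unfolding q_def graph_integral_def laplacian_def by (intro continuous_intros) auto
    \<comment> \<open>Subtracting the \<lambda> term from the eigenvalue estimate leaves the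
      spectral gap as coercivity constant.\<close>
    show "(lambda1 E \<omega> \<mu> \<Omega> - lam) * (\<Sum>x\<in>\<Omega>. \<mu> x * (u x)\<^sup>2) \<le> q u u" if "u \<in> H \<Omega>" for u
      using lambda1_le_quotient[OF fin that]
      unfolding q_def S_def graph_integral_def by (simp add: power2_eq_square algebra_simps)
  qed (use assms measure_pos in auto)
  \<comment> \<open>Vanishing of \<open>denergy\<close> is the weak equation with the \<lambda> term
    moved to the left, and \<open>Cc \<Omega>\<close> and \<open>H \<Omega>\<close> are the same set
    of test functions.\<close>
  have weak: "weak_solution E \<omega> \<mu> \<Omega> lam p \<epsilon> f u" if u: "critical (\<lambda>x. \<epsilon> * f x) u" for \<epsilon> u
    unfolding weak_solution_def
  proof (intro conjI ballI)
    show "u \<in> H \<Omega>" using u unfolding critical_def by simp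
    fix \<phi> assume "\<phi> \<in> Cc \<Omega>"
    then have "denergy (\<lambda>x. \<epsilon> * f x) u \<phi> = 0" using u unfolding critical_def Cc_def H_def by simp
    then have "q u \<phi> = (\<Sum>x\<in>\<Omega>. \<mu> x * (\<bar>u x\<bar> powr (p - 2) * u x * \<phi> x)) + pairing (\<lambda>x. \<epsilon> * f x) \<phi>"
      unfolding denergy_def by simp
    moreover have "pairing (\<lambda>x. \<epsilon> * f x) \<phi> = \<epsilon> * graph_integral \<mu> \<Omega> (\<lambda>x. f x * \<phi> x)"
      unfolding pairing_def graph_integral_def by (simp add: sum_distrib_left algebra_simps)
    ultimately show "graph_integral \<mu> (\<Omega> \<union> boundary E \<Omega>) (\<lambda>x. laplacian E \<omega> \<mu> u x * laplacian E \<omega> \<mu> \<phi> x) =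
          lam * graph_integral \<mu> \<Omega> (\<lambda>x. u x * \<phi> x)
          + graph_integral \<mu> \<Omega> (\<lambda>x. \<bar>u x\<bar> powr (p - 2) * u x * \<phi> x)
          + \<epsilon> * graph_integral \<mu> \<Omega> (\<lambda>x. f x * \<phi> x)"
      unfolding q_def S_def by (simp add: graph_integral_def)
  qed
  show ?thesis using two_critical_points[of f] weak by metis
qed

end
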